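(* Fix real numbers $a>0$, $b$, $c\neq 0$ and a measurement $\mathbf z=(z_1,z_2)\in\mathbb R^2$, and let $\lambda_2,\lambda_1,\lambda_0$ be the coefficient functions of $\mathbf z$ defined in the context, $\Delta_\rho=\lambda_1^2-4\lambda_2\lambda_0$. Suppose that the quadratic equation $\lambda_2\rho^2+\lambda_1\rho+\lambda_0=0$ has two distinct feasible (real and positive) roots, labelled $\rho_{\mathrm{phys}}$ (physical) and $\rho_{\mathrm{sp}}$ (spurious), so that $\Delta_\rho>0$. Then $\lambda_2>0$. Moreover, let $\varsigma_{\mathrm{phys}}=\|\nabla_{\mathbf z}\rho_{\mathrm{phys}}\|$ and $\varsigma_{\mathrm{sp}}=\|\nabla_{\mathbf z}\rho_{\mathrm{sp}}\|$ be the sensitivities of the two roots, with $\varsigma_{\mathrm{sp}}\neq 0$, and let $\Gamma=\varsigma_{\mathrm{phys}}/\varsigma_{\mathrm{sp}}$. Then $$\Gamma>1\iff(\rho_{\mathrm{phys}}-\rho_{\mathrm{sp}})\,Q>0,$$ where, with $S=-\lambda_1/\lambda_2$, $P=\lambda_0/\lambda_2$, and $\nabla_{\mathbf z}\lambda_k=[\partial_{z_1}\lambda_k,\partial_{z_2}\lambda_k]^T$ for $k\in\{0,1,2\}$, $$\begin{aligned}Q={}&\|\nabla_{\mathbf z}\lambda_2\|^{2}\,S(S^{2}-2P)+2\,(\nabla_{\mathbf z}\lambda_2\cdot\nabla_{\mathbf z}\lambda_1)(S^{2}-P)\\&+\bigl(\|\nabla_{\mathbf z}\lambda_1\|^{2}+2\,\nabla_{\mathbf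 z}\lambda_2\cdot\nabla_{\mathbf z}\lambda_0\bigr)\,S+2\,\nabla_{\mathbf z}\lambda_1\cdot\nabla_{\mathbf z}\lambda_0 .\end{aligned}$$
   Context: Setting: planar time-difference-of-arrival localization with three non-collinear receivers placed, in a canonical frame, at $\mathbf a_0=\mathbf 0$, $\mathbf a_1=[a,0]^T$, $\mathbf a_2=[b,c]^T$ with $a>0$, $c\neq0$. For an emitter at $\mathbf y\in\mathbb R^2$ with reference range $\rho=\|\mathbf y\|$, the range-difference equations are $\|\mathbf y-\mathbf a_i\|-\rho=z_i$, $i=1,2$. Squaring them and using $\rho^2=\mathbf y^T\mathbf y$ gives the linear equations $\mathbf a_i^T\mathbf y=\tfrac12(\|\mathbf a_i\|^2-z_i^2)-z_i\rho$, $i=1,2$, whose unique solution is affine in $\rho$: $\mathbf y(\rho)=\boldsymbol\alpha+\boldsymbol\beta\rho$, where $\boldsymbol\alpha,\boldsymbol\beta\in\mathbb R^2$ are the functions of $\mathbf z$ given by $$\boldsymbol\alpha=\begin{bmatrix}a&0\\ b&c\end{bmatrix}^{-1}\begin{bmatrix}\tfrac12(a^2-z_1^2)\\ \tfrac12(b^2+c^2-z_2^2)\end{bmatrix},\qquad \boldsymbol\beta=-\begin{bmatrix}a&0\\ b&c\end{bmatrix}^{-1}\begin{bmatrix}z_1\\ z_2\end{bmatrix}.$$ Imposing $\rho^2=\|\boldsymbol\alpha+\boldsymbol\beta\rho\|^2$ yields the quadratic $\lambda_2\rho^2+\lambda_1\rho+\lambda_0=0$ with $$\lambda_2=\boldsymbol\beta^T\boldsymbol\beta-1,\qquad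 \lambda_1=2\boldsymbol\alpha^T\boldsymbol\beta,\qquad \lambda_0=\boldsymbol\alpha^T\boldsymbol\alpha,$$ all regarded as functions of $\mathbf z$ for fixed $a,b,c$. Its roots (when $\lambda_2\ne0$, $\Delta_\rho\ge0$) are $\rho_m=\bigl(-\lambda_1+(-1)^{m+1}\sqrt{\Delta_\rho}\bigr)/(2\lambda_2)$, $m\in\{1,2\}$. A root is feasible if it is real and positive. The physical root is the one corresponding to the true emitter position and the spurious root is the other one. Near a point $\mathbf z$ where $\lambda_2\neq 0$ and $\Delta_\rho>0$, each root $\rho_m$ is a smooth function of $\mathbf z$, and $\nabla_{\mathbf z}\rho_m=[\partial_{z_1}\rho_m,\partial_{z_2}\rho_m]^T$ denotes its gradient. Throughout, $\|\cdot\|$ is the Euclidean norm and $\cdot$ the Euclidean inner product on $\mathbb R^2$. *)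

theory Defs
  imports "HOL-Analysis.Analysis"
begin

(* Throughout, a, b, c fix the receivers (0,0), (a,0), (b,c), and z is the vector of
   range differences. *)

definition receiver_matrix :: "real \<Rightarrow> real \<Rightarrow> real \<Rightarrow> real^2^2" where
  "receiver_matrix a b c = vector [vector [a, 0], vector [b, c]]"

definition alpha :: "real \<Rightarrow> real \<Rightarrow> real \<Rightarrow> real^2 \<Rightarrow> real^2" where
  "alpha a b c z = matrix_inv (receiver_matrix a b c) *v
     vector [(a\<^sup>2 - (z $ 1)\<^sup>2) / 2, (b\<^sup>2 + c\<^sup>2 - (z $ 2)\<^sup>2) / 2]"

definition beta :: "real \<Rightarrow> real \<Rightarrow> real \<Rightarrow> real^2 \<Rightarrow> real^2" where
  "beta a b c z = - (matrix_inv (receiver_matrix a b c) *v z)"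

(* Coefficients of the quadratic in the reference range r that results from imposing
   r^2 = norm (alpha + r * beta)^2. *)

definition lam2 :: "real \<Rightarrow> real \<Rightarrow> real \<Rightarrow> real^2 \<Rightarrow> real" where
  "lam2 a b c z = beta a b c z \<bullet> beta a b c z - 1"

definition lam1 :: "real \<Rightarrow> real \<Rightarrow> real \<Rightarrow> real^2 \<Rightarrow> real" where
  "lam1 a b c z = 2 * (alpha a b c z \<bullet> beta a b c z)"

definition lam0 :: "real \<Rightarrow> real \<Rightarrow> real \<Rightarrow> real^2 \<Rightarrow> real" where
  "lam0 a b c z = alpha a b c z \<bullet> alpha a b c z"

definition discr :: "real \<Rightarrow> real \<Rightarrow> real \<Rightarrow> real^2 \<Rightarrow> real" where
  "discr a b c z = (lam1 a b c z)\<^sup>2 - 4 * lam2 a b c z * lam0 a b c z"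

definition feasible_root :: "real \<Rightarrow> real \<Rightarrow> real \<Rightarrow> real^2 \<Rightarrow> real \<Rightarrow> bool" where
  "feasible_root a b c z r \<longleftrightarrow>
     lam2 a b c z * r\<^sup>2 + lam1 a b c z * r + lam0 a b c z = 0 \<and> r > 0"

(* The two root branches, m = 1 and m = 2, as functions of z.  The formula yields roots
   only where lam2 is nonzero and discr is nonnegative; elsewhere its value (division by
   zero, sqrt of a negative number) has no meaning. *)

definition range_root :: "real \<Rightarrow> real \<Rightarrow> real \<Rightarrow> nat \<Rightarrow> real^2 \<Rightarrow> real" where
  "range_root a b c m z =
     (- lam1 a b c z + (-1) ^ (m + 1) * sqrt (discr a b c z)) / (2 * lam2 a b c z)"

definition grad :: "(real^2 \<Rightarrow> real) \<Rightarrow> real^2 \<Rightarrow> real^2" where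
  "grad f z = vector [deriv (\<lambda>t. f (vector [t, z $ 2])) (z $ 1),
                      deriv (\<lambda>t. f (vector [z $ 1, t])) (z $ 2)]"

definition sensitivity :: "real \<Rightarrow> real \<Rightarrow> real \<Rightarrow> nat \<Rightarrow> real^2 \<Rightarrow> real" where
  "sensitivity a b c m z = norm (grad (range_root a b c m) z)"

definition sum_of_roots :: "real \<Rightarrow> real \<Rightarrow> real \<Rightarrow> real^2 \<Rightarrow> real" where
  "sum_of_roots a b c z = - lam1 a b c z / lam2 a b c z"

definition product_of_roots :: "real \<Rightarrow> real \<Rightarrow> real \<Rightarrow> real^2 \<Rightarrow> real" where
  "product_of_roots a b c z = lam0 a b c z / lam2 a b c z"

definition Q_form :: "real \<Rightarrow> real \<Rightarrow> real \<Rightarrow> real^2 \<Rightarrow> real" where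
  "Q_form a b c z =
     (let S = sum_of_roots a b c z; P = product_of_roots a b c z;
          g2 = grad (lam2 a b c) z; g1 = grad (lam1 a b c) z; g0 = grad (lam0 a b c) z
      in (norm g2)\<^sup>2 * (S * (S\<^sup>2 - 2 * P)) + 2 * (g2 \<bullet> g1) * (S\<^sup>2 - P)
         + ((norm g1)\<^sup>2 + 2 * (g2 \<bullet> g0)) * S + 2 * (g1 \<bullet> g0))"

end

theory Submission
  imports Defs
begin

text \<open>
  Distinct positive roots have a positive product \<open>lam0 / lam2\<close>, and \<open>lam0 \<ge> 0\<close>, so
  \<open>lam2 > 0\<close> once \<open>lam2 = 0\<close> is excluded. In that case the quadratic would vanish identically,
  giving \<open>alpha = 0\<close> and \<open>norm beta = 1\<close>: then the equality case of Cauchy-Schwarz makes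
  \<open>beta\<close> parallel to both \<open>(a, 0)\<close> and \<open>(b, c)\<close>, which are not collinear.
  For the sensitivities, implicit differentiation of the quadratic at a root \<open>r\<close> gives
  \<open>(2 lam2 r + lam1) \<nabla>r = - (r\<^sup>2 \<nabla>lam2 + r \<nabla>lam1 + \<nabla>lam0)\<close>, where the
  square of the factor on the left is the discriminant for both roots. So the comparison is
  between the values of the quartic \<open>\<parallel>r\<^sup>2 \<nabla>lam2 + r \<nabla>lam1 + \<nabla>lam0\<parallel>\<^sup>2\<close>
  at the two roots, whose divided difference is \<open>Q\<close>.
\<close>

lemma matrix_inv_receiver_matrix_mult_vec:
  assumes "a \<noteq> 0" "c \<noteq> 0"
  shows "matrix_inv (receiver_matrix a b c) *v v = vector [v $ 1 / a, (v $ 2 - b * v $ 1 / a) / c]"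
proof -
  let ?A = "receiver_matrix a b c"
  let ?w = "vector [v $ 1 / a, (v $ 2 - b * v $ 1 / a) / c] :: real^2"
  have "det ?A \<noteq> 0"
    using assms by (simp add: receiver_matrix_def det_2)
  hence "\<exists>B. ?A ** B = mat 1 \<and> B ** ?A = mat 1"
    by (simp flip: invertible_det_nz add: invertible_def)
  \<comment> \<open>\<open>matrix_inv\<close> is a Hilbert choice, so its defining property needs
    the existence of an inverse first.\<close>
  hence inv: "matrix_inv ?A ** ?A = mat 1"
    unfolding matrix_inv_def by (rule someI2_ex) simp
  have "?A *v ?w = v"
    using assms
    by (simp add: vec_eq_iff forall_2 matrix_vector_mult_def sum_2 receiver_matrix_def)
  hence "matrix_inv ?A *v v = (matrix_inv ?A ** ?A) *v ?w"
    by (simp flip: matrix_vector_mul_assoc)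
  thus ?thesis
    by (simp add: inv)
qed

lemma alpha_eq:
  assumes "a \<noteq> 0" "c \<noteq> 0"
  shows "alpha a b c z = vector [(a\<^sup>2 - (z $ 1)\<^sup>2) / 2 / a,
    ((b\<^sup>2 + c\<^sup>2 - (z $ 2)\<^sup>2) / 2 - b * ((a\<^sup>2 - (z $ 1)\<^sup>2) / 2) / a) / c]"
  using assms by (simp add: alpha_def matrix_inv_receiver_matrix_mult_vec)

lemma beta_eq:
  assumes "a \<noteq> 0" "c \<noteq> 0"
  shows "beta a b c z = - vector [z $ 1 / a, (z $ 2 - b * z $ 1 / a) / c]"
  using assms by (simp add: beta_def matrix_inv_receiver_matrix_mult_vec)

lemma vec_nth_differentiable_vector:
  "(\<lambda>t. (vector [t, y] :: real^2) $ i) differentiable (at x)"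
  "(\<lambda>t. (vector [y, t] :: real^2) $ i) differentiable (at x)"
  using exhaust_2[of i] by auto

text \<open>The curve \<open>g\<close> stands for either coordinate line through \<open>z\<close>,
  so that both partial derivatives are covered at once. By the explicit forms of
  \<open>alpha\<close> and \<open>beta\<close>, everything is polynomial in the components of
  \<open>g t\<close>.\<close>

lemma lam_differentiable:
  assumes "a \<noteq> 0" "c \<noteq> 0" "\<And>i. (\<lambda>t. g t $ i) differentiable (at x)"
  shows "(\<lambda>t. lam2 a b c (g t)) differentiable (at x)"
    and "(\<lambda>t. lam1 a b c (g t)) differentiable (at x)"
    and "(\<lambda>t. lam0 a b c (g t)) differentiable (at x)"
  unfolding lam2_def lam1_def lam0_def alpha_eq[OF assms(1,2)] beta_eq[OF assms(1,2)]
    inner_vec_def sum_2 inner_real_def vector_2 vector_uminus_component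
  using assms by (auto intro!: derivative_intros)

text \<open>Implicit differentiation in one real variable, to be used along each coordinate line.
  Squaring removes the branch sign \<open>e\<close>, so one identity serves both roots.\<close>

lemma quadratic_root_deriv:
  fixes f g h :: "real \<Rightarrow> real" and e t :: real
  defines "R \<equiv> \<lambda>t. (- g t + e * sqrt ((g t)\<^sup>2 - 4 * f t * h t)) / (2 * f t)"
  assumes "f differentiable (at t)" "g differentiable (at t)" "h differentiable (at t)"
    and "f t \<noteq> 0" and pos: "(g t)\<^sup>2 - 4 * f t * h t > 0" and "e\<^sup>2 = 1"
  shows "((g t)\<^sup>2 - 4 * f t * h t) * (deriv R t)\<^sup>2
    = ((R t)\<^sup>2 * deriv f t + R t * deriv g t + deriv h t)\<^sup>2"
proof -
  define D where "D = (\<lambda>t. (g t)\<^sup>2 - 4 * f t * h t)"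
  define u where "u = (\<lambda>t. e * sqrt (D t))"
  define f' where "f' = deriv f t"
  define g' where "g' = deriv g t"
  define h' where "h' = deriv h t"
  have f: "(f has_real_derivative f') (at t)" and g: "(g has_real_derivative g') (at t)"
    and h: "(h has_real_derivative h') (at t)"
    using assms by (simp_all add: f'_def g'_def h'_def DERIV_deriv_iff_real_differentiable)
  have D: "(D has_real_derivative 2 * g t * g' - 4 * (f' * h t + f t * h')) (at t)"
    unfolding D_def by (auto intro!: derivative_eq_intros f g h)
  define u' where "u' = e * ((2 * g t * g' - 4 * (f' * h t + f t * h')) * (inverse (sqrt (D t)) / 2))"
  have Dpos: "D t > 0" using pos by (simp add: D_def)
  have u: "(u has_real_derivative u') (at t)"
    unfolding u_def u'_def using Dpos
    by (auto intro!: derivative_eq_intros D simp: field_simps)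
  have u2: "(u t)\<^sup>2 = D t" using Dpos \<open>e\<^sup>2 = 1\<close> by (simp add: u_def power_mult_distrib)
  \<comment> \<open>The product with \<open>u t\<close> frees the derivative of the square root:
    this is half the derivative of \<open>u\<^sup>2 = D\<close>.\<close>
  have uu': "u t * u' = g t * g' - 2 * (f' * h t + f t * h')"
  proof -
    have "u t * u' = e\<^sup>2 * (sqrt (D t) * inverse (sqrt (D t))) * (g t * g' - 2 * (f' * h t + f t * h'))"
      by (simp add: u_def u'_def power2_eq_square)
    thus ?thesis using Dpos \<open>e\<^sup>2 = 1\<close> by simp
  qed
  have R_eq: "R = (\<lambda>t. (- g t + u t) / (2 * f t))"
    by (simp add: R_def u_def D_def)
  define R' where "R' = ((- g' + u') * (2 * f t) - (- g t + u t) * (2 * f')) / (2 * f t * (2 * f t))"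
  have R: "(R has_real_derivative R') (at t)"
    unfolding R_eq R'_def using \<open>f t \<noteq> 0\<close>
    by (auto intro!: derivative_eq_intros f g u)
  \<comment> \<open>So \<open>u t\<close> is the derivative of the quadratic with respect to the
    unknown, taken at the root.\<close>
  have ut: "u t = 2 * f t * R t + g t"
    using \<open>f t \<noteq> 0\<close> by (simp add: R_eq)
  have R': "2 * f t * R' = u' - g' - 2 * f' * R t"
    using \<open>f t \<noteq> 0\<close> by (simp add: R'_def R_eq field_simps)
  have root: "h t = - f t * (R t)\<^sup>2 - g t * R t"
  proof -
    have "4 * f t * (h t + f t * (R t)\<^sup>2 + g t * R t) = (u t)\<^sup>2 - D t"
      unfolding ut D_def by (simp add: power2_eq_square algebra_simps)
    thus ?thesis using u2 \<open>f t \<noteq> 0\<close> by simp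
  qed
  \<comment> \<open>The factor \<open>u t\<close> makes \<open>uu'\<close> applicable; after
    \<open>root\<close> eliminates \<open>h t\<close>, the factor \<open>2 * f t\<close> splits off
    and cancels.\<close>
  have "2 * f t * (u t * R') = u t * u' - u t * g' - 2 * f' * R t * u t"
    using arg_cong[OF R', of "\<lambda>x. u t * x"] by (simp add: algebra_simps)
  also have "\<dots> = 2 * f t * - ((R t)\<^sup>2 * f' + R t * g' + h')"
    unfolding uu' unfolding ut root by (simp add: power2_eq_square algebra_simps)
  finally have "u t * R' = - ((R t)\<^sup>2 * f' + R t * g' + h')"
    using \<open>f t \<noteq> 0\<close> by simp
  hence "(u t)\<^sup>2 * R'\<^sup>2 = ((R t)\<^sup>2 * f' + R t * g' + h')\<^sup>2"
    by (metis power_mult_distrib power2_minus)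
  thus ?thesis
    using u2 DERIV_imp_deriv[OF R] by (simp add: D_def f'_def g'_def h'_def)
qed

lemma sensitivity_sq:
  fixes z :: "real^2" and m :: nat
  assumes "a \<noteq> 0" "c \<noteq> 0" "lam2 a b c z \<noteq> 0" "discr a b c z > 0"
  defines "r \<equiv> range_root a b c m z"
  shows "discr a b c z * (sensitivity a b c m z)\<^sup>2
    = (norm (r\<^sup>2 *\<^sub>R grad (lam2 a b c) z + r *\<^sub>R grad (lam1 a b c) z + grad (lam0 a b c) z))\<^sup>2"
proof -
  have z: "vector [z $ 1, z $ 2] = z"
    by (simp add: vec_eq_iff forall_2)
  have partial: "discr a b c z * (deriv (\<lambda>t. range_root a b c m (g t)) x)\<^sup>2
    = (r\<^sup>2 * deriv (\<lambda>t. lam2 a b c (g t)) x + r * deriv (\<lambda>t. lam1 a b c (g t)) x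
       + deriv (\<lambda>t. lam0 a b c (g t)) x)\<^sup>2"
    if g: "\<And>i. (\<lambda>t. g t $ i) differentiable (at x)" and gx: "g x = z" for g :: "real \<Rightarrow> real^2" and x
    using quadratic_root_deriv[where e = "(-1) ^ (m + 1)",
        OF lam_differentiable(1)[OF assms(1,2) g, where b = b]
          lam_differentiable(2)[OF assms(1,2) g, where b = b]
          lam_differentiable(3)[OF assms(1,2) g, where b = b]]
      assms(3,4) gx
    by (simp add: range_root_def discr_def r_def flip: power_mult)
  \<comment> \<open>The squared norms are the sums of the identities along the two coordinate
    lines.\<close>
  show ?thesis
    using partial[of "\<lambda>t. vector [t, z $ 2]" "z $ 1"] partial[of "\<lambda>t. vector [z $ 1, t]" "z $ 2"]
    by (simp add: sensitivity_def grad_def power2_norm_eq_inner inner_vec_def sum_2 z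
        vec_nth_differentiable_vector algebra_simps flip: power2_eq_square)
qed

text \<open>Expanding the norms leaves differences of the powers of \<open>r\<close> and
  \<open>s\<close> of order 4, 3, 2 and 1. Each is \<open>r - s\<close> times a symmetric
  polynomial, written here in \<open>r + s\<close> and \<open>r * s\<close>.\<close>

lemma quartic_norm_diff:
  fixes u v w :: "'a::real_inner" and r s :: real
  shows "(norm (r\<^sup>2 *\<^sub>R u + r *\<^sub>R v + w))\<^sup>2 - (norm (s\<^sup>2 *\<^sub>R u + s *\<^sub>R v + w))\<^sup>2
    = (r - s) * ((norm u)\<^sup>2 * ((r + s) * ((r + s)\<^sup>2 - 2 * (r * s)))
        + 2 * (u \<bullet> v) * ((r + s)\<^sup>2 - r * s)
        + ((norm v)\<^sup>2 + 2 * (u \<bullet> w)) * (r + s) + 2 * (v \<bullet> w))"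
  unfolding power2_norm_eq_inner
  by (simp add: inner_simps inner_commute[of v u] inner_commute[of w u] inner_commute[of w v])
     (simp add: power2_eq_square algebra_simps)

lemma lam2_lam0_not_both_zero:
  assumes "a \<noteq> 0" "c \<noteq> 0" "lam2 a b c z = 0"
  shows "lam0 a b c z \<noteq> 0"
proof
  assume "lam0 a b c z = 0"
  hence "alpha a b c z = 0" by (simp add: lam0_def)
  hence "alpha a b c z $ 1 = 0" "alpha a b c z $ 2 = 0" by simp_all
  hence z1: "(z $ 1)\<^sup>2 = a\<^sup>2" and z2: "(z $ 2)\<^sup>2 = b\<^sup>2 + c\<^sup>2"
    using assms(1,2) by (simp_all add: alpha_eq)
  \<comment> \<open>\<open>x\<close> and \<open>y\<close> are the components of
    \<open>- beta\<close>. A vanishing \<open>alpha\<close> forces x = 1 or x = -1, so the unit norm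
    leaves no room for \<open>y\<close>.\<close>
  define x where "x = z $ 1 / a"
  define y where "y = (z $ 2 - b * x) / c"
  have "x\<^sup>2 = 1" using z1 assms(1) by (simp add: x_def power_divide)
  moreover have "x\<^sup>2 + y\<^sup>2 = 1"
    using assms
    by (simp add: lam2_def beta_eq inner_vec_def sum_2 x_def y_def power2_eq_square)
  ultimately have "y = 0" by simp
  hence "z $ 2 = b * x" using assms(2) by (simp add: y_def)
  hence "(z $ 2)\<^sup>2 = b\<^sup>2" using \<open>x\<^sup>2 = 1\<close> by (simp add: power_mult_distrib)
  thus False using z2 assms(2) by simp
qed

lemma two_feasible_roots_imp_pos:
  assumes "a \<noteq> 0" "c \<noteq> 0" "r \<noteq> s" "feasible_root a b c z r" "feasible_root a b c z s"
  shows "lam2 a b c z > 0" and "discr a b c z > 0"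
proof -
  define p q k where "p = lam2 a b c z" and "q = lam1 a b c z" and "k = lam0 a b c z"
  have r: "p * r\<^sup>2 + q * r + k = 0" "r > 0" and s: "p * s\<^sup>2 + q * s + k = 0" "s > 0"
    using assms(4,5) by (simp_all add: feasible_root_def p_def q_def k_def)
  \<comment> \<open>Vieta's relations are obtained by subtraction, without dividing by
    \<open>p\<close>, which is not yet known to be nonzero. They show that \<open>p = 0\<close>
    would force \<open>k = 0\<close>.\<close>
  have "(r - s) * (p * (r + s) + q) = 0"
    using r(1) s(1) by (simp add: power2_eq_square algebra_simps)
  hence q: "q = - p * (r + s)" using \<open>r \<noteq> s\<close> by simp
  have k: "k = p * (r * s)"
    using r(1) unfolding q by (simp add: power2_eq_square algebra_simps)
  have "p \<noteq> 0"
    using lam2_lam0_not_both_zero[OF assms(1,2)] k by (auto simp: p_def k_def)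
  moreover have "k \<ge> 0" by (simp add: k_def lam0_def)
  hence "p \<ge> 0"
    using k mult_pos_pos[OF r(2) s(2)] by (simp add: zero_le_mult_iff)
  ultimately show "lam2 a b c z > 0" by (simp add: p_def)
  have "discr a b c z = p\<^sup>2 * (r - s)\<^sup>2"
    unfolding discr_def p_def[symmetric] q_def[symmetric] k_def[symmetric] q k
    by (simp add: power2_eq_square algebra_simps)
  thus "discr a b c z > 0" using \<open>p \<noteq> 0\<close> \<open>r \<noteq> s\<close> by simp
qed

lemma range_root_sum_prod:
  assumes "lam2 a b c z \<noteq> 0" "discr a b c z \<ge> 0" "{m, n} = {1, 2::nat}"
  shows "range_root a b c m z + range_root a b c n z = sum_of_roots a b c z"
    and "range_root a b c m z * range_root a b c n z = product_of_roots a b c z"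
proof -
  define p q k D where "p = lam2 a b c z" and "q = lam1 a b c z" and "k = lam0 a b c z"
    and "D = discr a b c z"
  have D: "sqrt D * sqrt D = q\<^sup>2 - 4 * p * k" and "p \<noteq> 0"
    using assms by (simp_all add: D_def discr_def p_def q_def k_def)
  have "(- q + sqrt D) / (2 * p) * ((- q - sqrt D) / (2 * p)) = (q\<^sup>2 - sqrt D * sqrt D) / (4 * p\<^sup>2)"
    by (simp add: power2_eq_square algebra_simps)
  also have "\<dots> = k / p"
    unfolding D using \<open>p \<noteq> 0\<close> by (simp add: power2_eq_square)
  finally have prod: "(- q + sqrt D) / (2 * p) * ((- q - sqrt D) / (2 * p)) = k / p" .
  have sum: "(- q + sqrt D) / (2 * p) + (- q - sqrt D) / (2 * p) = - q / p"
    using \<open>p \<noteq> 0\<close> by (simp add: field_simps)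
  \<comment> \<open>Either labelling is allowed; sum and product are symmetric in the two
    branches.\<close>
  have "m = 1 \<and> n = 2 \<or> m = 2 \<and> n = 1"
    using assms(3) by (auto simp: doubleton_eq_iff)
  thus "range_root a b c m z + range_root a b c n z = sum_of_roots a b c z"
    and "range_root a b c m z * range_root a b c n z = product_of_roots a b c z"
    using sum prod
    by (auto simp: range_root_def sum_of_roots_def product_of_roots_def p_def q_def k_def D_def
        add.commute mult.commute)
qed

theorem proposition1:
  fixes a b c :: real and z :: "real^2" and m_phys m_sp :: nat
  assumes "a > 0" and "c \<noteq> 0"
    and "\<exists>r s. r \<noteq> s \<and> feasible_root a b c z r \<and> feasible_root a b c z s"
    and "{m_phys, m_sp} = {1, 2}"
  shows "discr a b c z > 0 \<and> lam2 a b c z > 0 \<and>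
    (sensitivity a b c m_sp z \<noteq> 0 \<longrightarrow>
      (sensitivity a b c m_phys z / sensitivity a b c m_sp z > 1 \<longleftrightarrow>
       (range_root a b c m_phys z - range_root a b c m_sp z) * Q_form a b c z > 0))"
proof (intro conjI impI)
  have "a \<noteq> 0" using assms(1) by simp
  show D: "discr a b c z > 0" and L: "lam2 a b c z > 0"
    using assms(3) two_feasible_roots_imp_pos[OF \<open>a \<noteq> 0\<close> assms(2)] by auto
  let ?p = "sensitivity a b c m_phys z" and ?s = "sensitivity a b c m_sp z"
  let ?r1 = "range_root a b c m_phys z" and ?r2 = "range_root a b c m_sp z"
  assume "?s \<noteq> 0"
  have "?p \<ge> 0" "?s \<ge> 0" by (simp_all add: sensitivity_def)
  have L0: "lam2 a b c z \<noteq> 0" and D0: "discr a b c z \<ge> 0" using L D by simp_all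
  \<comment> \<open>The discriminant is a common positive factor, so the sign of the right-hand side
    decides which squared sensitivity is larger.\<close>
  have "discr a b c z * (?p\<^sup>2 - ?s\<^sup>2) = (?r1 - ?r2) * Q_form a b c z"
    unfolding right_diff_distrib[of "discr a b c z"] sensitivity_sq[OF \<open>a \<noteq> 0\<close> assms(2) L0 D] quartic_norm_diff
      range_root_sum_prod[OF L0 D0 assms(4)]
    by (simp add: Q_form_def Let_def)
  hence "(?r1 - ?r2) * Q_form a b c z > 0 \<longleftrightarrow> discr a b c z * (?p\<^sup>2 - ?s\<^sup>2) > 0"
    by simp
  also have "\<dots> \<longleftrightarrow> ?s\<^sup>2 < ?p\<^sup>2"
    using D by (simp add: zero_less_mult_iff)
  also have "\<dots> \<longleftrightarrow> ?s < ?p"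
    using \<open>?p \<ge> 0\<close> \<open>?s \<ge> 0\<close> by (meson not_le pos2 power_mono_iff)
  also have "\<dots> \<longleftrightarrow> ?p / ?s > 1"
    using \<open>?s \<noteq> 0\<close> \<open>?s \<ge> 0\<close> by (simp add: less_divide_eq)
  finally show "?p / ?s > 1 \<longleftrightarrow> (?r1 - ?r2) * Q_form a b c z > 0" by simp
qed

end
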